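(* Let $n\ge 1$. The $f$-vector of the two descent polytopes $\mathrm{DP}_{\mathbf{z}_{n-1}}$ and $\mathrm{DP}_{\overline{\mathbf{z}_{n-1}}}$ is maximal among the $f$-vectors of all descent polytopes of dimension $n$. That is, for each $0\le i\le n-1$ and each non-alternating $\mathbf{x}\mathbf{y}$-word $\mathbf{v}$ of length $n-1$, the polytope $\mathrm{DP}_{\mathbf{z}_{n-1}}$ has (strictly) more faces of dimension $i$ than the $n$-dimensional descent polytope $\mathrm{DP}_{\mathbf{v}}$.
   Context: An $\mathbf{x}\mathbf{y}$-word is a finite (possibly empty) word in the two letters $\mathbf{x},\mathbf{y}$. A word $\mathbf{v}_1\cdots\mathbf{v}_k$ is alternating if $\mathbf{v}_i\ne\mathbf{v}_{i+1}$ for all $1\le i\le k-1$. Let $\mathbf{z}_m=\mathbf{x}\mathbf{y}\mathbf{x}\cdots$ be the alternating word of length $m$ starting with $\mathbf{x}$, and $\overline{\mathbf{z}_m}=\mathbf{y}\mathbf{x}\mathbf{y}\cdots$ the alternating word of length $m$ starting with $\mathbf{y}$ (both empty when $m=0$). Descent polytope: for an $\mathbf{x}\mathbf{y}$-word $\mathbf{v}=\mathbf{v}_1\cdots\mathbf{v}_{n-1}$ of length $n-1$ ($n\ge 1$), $\mathrm{DP}_{\mathbf{v}}\subset\mathbb{R}^n$ is the set of points $(x_1,\dots,x_n)$ with $0\le x_i\le 1$ for all $i$, and, for $1\le i\le n-1$, $x_i\le x_{i+1}$ if $\mathbf{v}_i=\mathbf{x}$ and $x_i\ge x_{i+1}$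 if $\mathbf{v}_i=\mathbf{y}$. It is an $n$-dimensional polytope, and every descent polytope of dimension $n$ is of this form. The $f$-vector of an $n$-dimensional polytope records its numbers $f_i$ of $i$-dimensional faces; $f$-vectors are compared entrywise. *)

theory Defs
  imports "HOL-Analysis.Analysis"
begin

datatype letter = X | Y

abbreviation alternating :: "letter list \<Rightarrow> bool" where
  "alternating \<equiv> distinct_adj"

definition z :: "nat \<Rightarrow> letter list" where
  "z m = map (\<lambda>i. if even i then X else Y) [0..<m]"

definition z_bar :: "nat \<Rightarrow> letter list" where
  "z_bar m = map (\<lambda>i. if even i then Y else X) [0..<m]"

(* The dimension n is the cardinality of the index type 'n, and e enumerates the
   coordinates: when e maps {1..n} bijectively onto 'n, the paper's x_i is x $ e i.
   Words are lists and hence indexed from 0, so the (i+1)-st letter v ! i relates the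
   coordinates x_(i+1) and x_(i+2). Intended for length v = n - 1. *)
definition DP :: "(nat \<Rightarrow> 'n::finite) \<Rightarrow> letter list \<Rightarrow> (real ^ 'n) set" where
  "DP e v = {x. (\<forall>j. 0 \<le> x $ j \<and> x $ j \<le> 1) \<and>
     (\<forall>i < length v. case v ! i of
        X \<Rightarrow> x $ e (i + 1) \<le> x $ e (i + 2)
      | Y \<Rightarrow> x $ e (i + 1) \<ge> x $ e (i + 2))}"

(* Entries beyond the dimension of P are 0. The order on functions is pointwise, so (\<le>)
   is the entrywise comparison of f-vectors. *)
definition f_vector :: "'a::euclidean_space set \<Rightarrow> nat \<Rightarrow> nat" where
  "f_vector P i = card {F. F face_of P \<and> aff_dim F = int i}"

lemma polytope_DP: "polytope (DP e v)"
proof -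
  define H :: "'a \<Rightarrow> 'a \<Rightarrow> (real ^ 'a) set"
    where "H a b = {x. inner (axis a 1 - axis b 1) x \<le> 0}" for a b
  define h where "h i = (case v ! i of X \<Rightarrow> H (e (i + 1)) (e (i + 2))
      | Y \<Rightarrow> H (e (i + 2)) (e (i + 1)))" for i
  have "polyhedron (h i)" for i
    by (simp add: h_def H_def polyhedron_halfspace_le split: letter.split)
  then have "polyhedron (\<Inter>(h ` {..<length v}))"
    by (intro polyhedron_Inter) auto
  moreover have "DP e v = cbox 0 1 \<inter> \<Inter>(h ` {..<length v})"
    by (auto simp: DP_def h_def H_def mem_box_cart inner_diff_left inner_axis' split: letter.splits)
  ultimately show ?thesis
    by (simp add: polytope_Int_polyhedron polytope_interval)
qed

text \<open>Hence the cardinalities in \<^const>\<open>f_vector\<close> count finite sets.\<close>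

lemma finite_faces_DP: "finite {F. F face_of DP e v \<and> aff_dim F = int i}"
  by (rule finite_subset[OF _ finite_polytope_faces[OF polytope_DP[of e v]]]) auto

end

theory Submission
  imports Defs "HOL-Computational_Algebra.Polynomial"
begin

text \<open>
  A nonempty face of a polytope given by inequalities is determined by the set of inequalities that
  are tight at its relative interior points. For a descent polytope, these are the conditions that a
  coordinate is 0, that it is 1, and that two neighbouring coordinates agree, so a face is a word
  with one mark for each coordinate, and its dimension is the number of
  maximal runs of equal coordinates whose value is not fixed to be 0 or 1. Which words occur is
  decided by the pairs of neighbouring marks and the last mark.
  
  Hence the polynomial that counts faces by dimension obeys a linear recursion when a letter is put in
  front of the word. The letter \<open>X\<close> adds \<open>(1 + t) high\<close> to it, and the letter \<open>Y\<close> adds \<open>(1 + t) low\<close>,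
  where \<open>high\<close> counts the faces on which the first coordinate is not constantly 0, and \<open>low\<close> those on
  which it is not constantly 1. Under \<open>X\<close> the pair \<open>(low, high)\<close> becomes
  \<open>(low + (1 + t) high, (1 + t) high)\<close>, and symmetrically for \<open>Y\<close>. After reading \<open>X\<close>
  therefore \<open>low\<close> is the larger one, so a following \<open>Y\<close> gains more faces than another \<open>X\<close>,
  and it also leaves a larger pair for the following steps. By induction, changing the letter in every
  step is optimal in every coefficient (\<open>alternating_dominates\<close>). A repeated letter loses faces in
  every dimension below that of the polytope, and the later letters carry this loss to the
  dimensions that they add (\<open>alternating_strictly_dominates\<close>). The translation between faces and words is
  \<open>f_vector_DP\<close>.
\<close>

section \<open>Faces of a polyhedron given by inequalities\<close>

definition cut_out :: "('a::euclidean_space \<times> real) set \<Rightarrow> 'a set" where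
  "cut_out H = {x. \<forall>(a, b)\<in>H. a \<bullet> x \<le> b}"

definition tight :: "('a::euclidean_space \<times> real) set \<Rightarrow> 'a \<Rightarrow> ('a \<times> real) set" where
  "tight H x = {(a, b)\<in>H. a \<bullet> x = b}"

definition face_through :: "('a::euclidean_space \<times> real) set \<Rightarrow> 'a \<Rightarrow> 'a set" where
  "face_through H x = {y\<in>cut_out H. tight H x \<subseteq> tight H y}"

text \<open>
  A tight inequality that attains its bound inside a segment attains it at both ends, since
  neither end may exceed the bound.
\<close>

lemma face_through_face_of: "face_through H x face_of cut_out H"
  unfolding face_of_def
proof (intro conjI ballI impI)
  show "face_through H x \<subseteq> cut_out H" by (auto simp: face_through_def)
  have "face_through H x = (\<Inter>(a, b)\<in>H. {y. a \<bullet> y \<le> b}) \<inter> (\<Inter>(a, b)\<in>tight H x. {y. a \<bullet> y = b})"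
    by (auto simp: face_through_def tight_def cut_out_def)
  then show "convex (face_through H x)"
    by (auto intro!: convex_Int convex_INT convex_halfspace_le convex_hyperplane)
next
  fix p q y assume pq: "p \<in> cut_out H" "q \<in> cut_out H" and y: "y \<in> face_through H x" "y \<in> open_segment p q"
  obtain u where u: "0 < u" "u < 1" "y = (1 - u) *\<^sub>R p + u *\<^sub>R q"
    using y(2) by (auto simp: in_segment)
  have "a \<bullet> p = b \<and> a \<bullet> q = b" if "(a, b) \<in> tight H x" for a b
  proof -
    have "a \<bullet> p \<le> b" "a \<bullet> q \<le> b" using that pq by (auto simp: cut_out_def tight_def)
    moreover have "(1 - u) * (b - a \<bullet> p) + u * (b - a \<bullet> q) = 0"
      using that y(1) by (auto simp: face_through_def tight_def u(3) algebra_simps)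
    ultimately show ?thesis using u(1,2)
      by (smt (verit) mult_nonneg_nonneg mult_pos_pos)
  qed
  then show "p \<in> face_through H x" "q \<in> face_through H x"
    using pq by (auto simp: face_through_def tight_def)
qed

text \<open>
  Every nonempty face consists of the points that are tight wherever a relative interior point
  \<open>x\<close> of it is. A segment of the face can be prolonged beyond \<open>x\<close>, which forces the inequalities
  that are tight at \<open>x\<close> to be tight on the face. Conversely, if \<open>y\<close> is tight wherever \<open>x\<close> is, the
  segment from \<open>y\<close> to \<open>x\<close> can be prolonged beyond \<open>x\<close> inside the polyhedron, because the inequalities
  that are strict at \<open>x\<close> leave some room; the face contains \<open>x\<close>, hence also the end \<open>y\<close>.
\<close>

lemma face_eq_face_through:
  assumes "finite H" "F face_of cut_out H" "F \<noteq> {}"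
  obtains x where "x \<in> cut_out H" "F = face_through H x"
proof -
  have "convex F" using assms(2) by (rule face_of_imp_convex)
  then obtain x where x: "x \<in> rel_interior F"
    using assms(3) rel_interior_eq_empty[of F] by auto
  then have xF: "x \<in> F" using rel_interior_subset by auto
  have FP: "F \<subseteq> cut_out H" using assms(2) by (rule face_of_imp_subset)
  have "F = face_through H x"
  proof (intro equalityI subsetI)
    fix y assume y: "y \<in> F"
    then obtain t where t: "t > 1" "(1 - t) *\<^sub>R y + t *\<^sub>R x \<in> F"
      using convex_rel_interior_iff[OF \<open>convex F\<close> assms(3)] x by blast
    have "a \<bullet> y = b" if "(a, b) \<in> H" "a \<bullet> x = b" for a b
    proof -
      have "a \<bullet> y \<le> b" "a \<bullet> ((1 - t) *\<^sub>R y + t *\<^sub>R x) \<le> b"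
        using that t(2) y FP by (auto simp: cut_out_def)
      then have "(t - 1) * (b - a \<bullet> y) \<le> 0" using that(2) by (simp add: algebra_simps)
      then show ?thesis using t(1) \<open>a \<bullet> y \<le> b\<close> by (smt (verit) mult_pos_pos)
    qed
    then show "y \<in> face_through H x" using y FP by (auto simp: face_through_def tight_def)
  next
    fix y assume y: "y \<in> face_through H x"
    show "y \<in> F"
    proof (cases "y = x")
      case False
      \<comment> \<open>The prolongation beyond \<open>x\<close>; it stays in the polyhedron for small positive \<open>t\<close>.\<close>
      define g where "g t = x + t *\<^sub>R (x - y)" for t :: real
      have "\<forall>\<^sub>F t in at_right 0. a \<bullet> g t \<le> b" if "(a, b) \<in> H" for a b
      proof (cases "a \<bullet> x = b")
        case True
        then have "a \<bullet> y = b" using that y by (auto simp: face_through_def tight_def)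
        then show ?thesis using True by (simp add: g_def algebra_simps)
      next
        case False
        then have "a \<bullet> x < b" using that xF FP by (force simp: cut_out_def)
        moreover have "((\<lambda>t. a \<bullet> g t) \<longlongrightarrow> a \<bullet> g 0) (at_right 0)"
          unfolding g_def by (intro tendsto_intros)
        ultimately have "\<forall>\<^sub>F t in at_right 0. a \<bullet> g t < b"
          using order_tendstoD(2)[of "\<lambda>t. a \<bullet> g t" "a \<bullet> x" "at_right 0" b] by (simp add: g_def)
        then show ?thesis by eventually_elim simp
      qed
      then have "\<forall>\<^sub>F t in at_right 0. g t \<in> cut_out H"
        unfolding cut_out_def using assms(1) by (auto simp: eventually_ball_finite_distrib)
      then have "\<forall>\<^sub>F t in at_right 0. g t \<in> cut_out H \<and> 0 < t"
        by (intro eventually_conj) (auto simp: eventually_at_right_less)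
      then obtain t where t: "0 < t" "g t \<in> cut_out H"
        using eventually_happens' trivial_limit_at_right_real by blast
      have "x = (1 - 1 / (1 + t)) *\<^sub>R y + (1 / (1 + t)) *\<^sub>R g t"
      proof -
        have "t *\<^sub>R y + g t = (1 + t) *\<^sub>R x" by (simp add: g_def algebra_simps)
        then have "(1 / (1 + t)) *\<^sub>R (t *\<^sub>R y + g t) = x" using t(1) by simp
        moreover have "1 - 1 / (1 + t) = t / (1 + t)" using t(1) by (simp add: field_simps)
        ultimately show ?thesis by (simp add: scaleR_add_right divide_inverse mult.commute)
      qed
      moreover have "y \<noteq> g t"
      proof
        assume "y = g t"
        then have "(1 + t) *\<^sub>R (x - y) = 0" by (simp add: g_def algebra_simps)
        then show False using False t(1) by simp
      qed
      ultimately have "x \<in> open_segment y (g t)"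
        using t(1) by (auto simp: in_segment intro!: exI[of _ "1 / (1 + t)"])
      then show "y \<in> F"
        using face_ofD[OF assms(2)] xF t(2) y by (auto simp: face_through_def)
    qed (use xF in simp)
  qed
  then show thesis using that xF FP by blast
qed

text \<open>
  Together with the preceding two lemmas: the nonempty faces are in bijection with the sets of
  inequalities that are exactly the tight ones at some point.
\<close>

lemma face_through_eq_iff:
  assumes "x \<in> cut_out H" "y \<in> cut_out H"
  shows "face_through H x = face_through H y \<longleftrightarrow> tight H x = tight H y"
proof
  assume "face_through H x = face_through H y"
  moreover have "x \<in> face_through H x" "y \<in> face_through H y"
    using assms by (auto simp: face_through_def)
  ultimately show "tight H x = tight H y" by (auto simp: face_through_def)
qed (auto simp: face_through_def)

text \<open>
  Near \<open>x\<close> the remaining inequalities are strict, so the face is a neighbourhood of \<open>x\<close> in the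
  affine space cut out by the tight equations.
\<close>

lemma aff_dim_face_through:
  assumes "finite H" "x \<in> cut_out H"
  shows "aff_dim (face_through H x) = aff_dim {y. tight H x \<subseteq> tight H y}"
proof -
  define A where "A = {y. tight H x \<subseteq> tight H y}"
  define U where "U = (\<Inter>(a, b)\<in>H - tight H x. {y. a \<bullet> y < b})"
  have A_eq: "A = (\<Inter>(a, b)\<in>tight H x. {y. a \<bullet> y = b})"
    by (auto simp: A_def tight_def)
  have "affine A" unfolding A_eq by (auto simp: affine_hyperplane)
  moreover have "open U" unfolding U_def using assms(1) by (auto simp: open_halfspace_lt)
  moreover have xAU: "x \<in> A \<inter> U"
    using assms(2) by (force simp: A_def U_def cut_out_def tight_def)
  ultimately have "affine hull (A \<inter> U) = A"
    using affine_hull_affine_Int_open[of A U] by (metis affine_hull_eq empty_iff)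
  moreover have "A \<inter> U \<subseteq> face_through H x"
  proof
    fix y assume y: "y \<in> A \<inter> U"
    have "a \<bullet> y \<le> b" if "(a, b) \<in> H" for a b
    proof (cases "(a, b) \<in> tight H x")
      case True
      then show ?thesis using y by (auto simp: A_def tight_def)
    next
      case False
      then have "(a, b) \<in> H - tight H x" using that by simp
      then show ?thesis using y unfolding U_def by fastforce
    qed
    then show "y \<in> face_through H x"
      using y by (auto simp: A_def face_through_def cut_out_def)
  qed
  moreover have "face_through H x \<subseteq> A" by (auto simp: A_def face_through_def)
  ultimately have "affine hull (face_through H x) = A"
    by (metis \<open>affine A\<close> hull_minimal hull_mono subset_antisym)
  then show ?thesis unfolding A_def by (metis aff_dim_affine_hull)
qed

section \<open>Encoding faces by words\<close>

text \<open>
  The marks record, coordinate by coordinate, which inequalities of a descent polytope are tight at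
  a point. A maximal run of equal coordinates with a value strictly between 0 and 1 moves freely
  inside the face; it is written \<open>Tied\<dots>Tied Free\<close>, so that the dimension of the face is
  the number of \<open>Free\<close> marks. In runs of zeros or ones the equalities between neighbours follow from
  the values and need no mark.
\<close>

datatype mark = AtZero | AtOne | Tied | Free

primrec code :: "real list \<Rightarrow> mark list" where
  "code [] = []"
| "code (y # ys) = (if y = 0 then AtZero else if y = 1 then AtOne
     else if ys \<noteq> [] \<and> hd ys = y then Tied else Free) # code ys"

text \<open>
  The points of a descent polytope as lists: unlike vectors, they allow an induction that changes
  the dimension.
\<close>

definition descent_lists :: "letter list \<Rightarrow> real list set" where
  "descent_lists v = {ys. length ys = Suc (length v) \<and> (\<forall>y\<in>set ys. 0 \<le> y \<and> y \<le> 1) \<and>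
     (\<forall>i<length v. case v ! i of X \<Rightarrow> ys ! i \<le> ys ! Suc i | Y \<Rightarrow> ys ! i \<ge> ys ! Suc i)}"

lemma length_code [simp]: "length (code ys) = length ys"
  by (induction ys) auto

lemma nth_code:
  "i < length ys \<Longrightarrow> code ys ! i = (if ys ! i = 0 then AtZero else if ys ! i = 1 then AtOne
     else if Suc i < length ys \<and> ys ! Suc i = ys ! i then Tied else Free)"
proof (induction ys arbitrary: i)
  case (Cons y ys)
  then show ?case by (cases i) (auto simp: hd_conv_nth)
qed simp

lemma Nil_descent_lists: "ys \<in> descent_lists [] \<longleftrightarrow> (\<exists>y. ys = [y] \<and> 0 \<le> y \<and> y \<le> 1)"
  by (auto simp: descent_lists_def length_Suc_conv)

lemma Cons_descent_lists:
  "y # ys \<in> descent_lists (l # v) \<longleftrightarrow> 0 \<le> y \<and> y \<le> 1 \<and>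
     (case l of X \<Rightarrow> y \<le> hd ys | Y \<Rightarrow> y \<ge> hd ys) \<and> ys \<in> descent_lists v"
  by (cases ys) (auto simp: descent_lists_def All_less_Suc2 split: letter.splits)

text \<open>
  Which mark a new first coordinate can get when its relation to the old first coordinate
  is the given letter.
\<close>

fun may_precede :: "letter \<Rightarrow> mark \<Rightarrow> mark \<Rightarrow> bool" where
  "may_precede l Tied r \<longleftrightarrow> r = Tied \<or> r = Free"
| "may_precede X AtZero r \<longleftrightarrow> True"
| "may_precede X Free r \<longleftrightarrow> r \<noteq> AtZero"
| "may_precede X AtOne r \<longleftrightarrow> r = AtOne"
| "may_precede Y AtZero r \<longleftrightarrow> r = AtZero"
| "may_precede Y Free r \<longleftrightarrow> r \<noteq> AtOne"
| "may_precede Y AtOne r \<longleftrightarrow> True"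

primrec marks :: "letter list \<Rightarrow> mark list set" where
  "marks [] = {[AtZero], [AtOne], [Free]}"
| "marks (l # v) = {s # w | s w. w \<in> marks v \<and> may_precede l s (hd w)}"

lemma hd_code:
  "ys \<noteq> [] \<Longrightarrow> hd (code ys) = (if hd ys = 0 then AtZero else if hd ys = 1 then AtOne
     else if tl ys \<noteq> [] \<and> hd (tl ys) = hd ys then Tied else Free)"
  by (cases ys) auto

lemma hd_descent_list:
  assumes "ys \<in> descent_lists v" shows "ys \<noteq> []" "0 \<le> hd ys" "hd ys \<le> 1"
proof -
  show "ys \<noteq> []" using assms by (auto simp: descent_lists_def)
  then have "hd ys \<in> set ys" by simp
  then show "0 \<le> hd ys" "hd ys \<le> 1" using assms by (auto simp: descent_lists_def)
qed

text \<open>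
  The local rules \<^const>\<open>may_precede\<close> are also sufficient: a new free coordinate can be chosen
  strictly between the old first coordinate and the bound 0 or 1 beyond which it may not go, so every admissible
  word is realised by a point.
\<close>

lemma code_descent_lists: "code ` descent_lists v = marks v"
proof (induction v)
  case Nil
  have "code [0] = [AtZero]" "code [1] = [AtOne]" "code [1/2] = [Free]" by auto
  moreover have "[0] \<in> descent_lists []" "[1] \<in> descent_lists []" "[1/2] \<in> descent_lists []"
    by (auto simp: descent_lists_def)
  ultimately have "marks [] \<subseteq> code ` descent_lists []"
    by (metis empty_subsetI image_eqI insert_subset marks.simps(1))
  moreover have "code ` descent_lists [] \<subseteq> marks []" by (auto simp: Nil_descent_lists)
  ultimately show ?case by blast
next
  case (Cons l v)
  show ?case
  proof (intro equalityI subsetI)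
    fix w assume "w \<in> code ` descent_lists (l # v)"
    then obtain ys where ys: "ys \<in> descent_lists (l # v)" "w = code ys" by blast
    then obtain y ys' where "ys = y # ys'" by (cases ys) (auto simp: descent_lists_def)
    with ys have *: "ys' \<in> descent_lists v" "0 \<le> y" "y \<le> 1"
       "case l of X \<Rightarrow> y \<le> hd ys' | Y \<Rightarrow> y \<ge> hd ys'" "w = code (y # ys')"
      by (auto simp: Cons_descent_lists)
    then have "code ys' \<in> marks v" using Cons by blast
    then show "w \<in> marks (l # v)"
      using * hd_descent_list[OF *(1)]
      by (cases l) (auto simp: hd_code)
  next
    fix w' assume "w' \<in> marks (l # v)"
    then obtain s w where w': "w' = s # w" "w \<in> marks v" "may_precede l s (hd w)" by auto
    then obtain ys where ys: "ys \<in> descent_lists v" "w = code ys" using Cons by blast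
    note h = hd_descent_list[OF ys(1)]
    define y where "y = (case s of AtZero \<Rightarrow> 0 | AtOne \<Rightarrow> 1 | Tied \<Rightarrow> hd ys
       | Free \<Rightarrow> (case l of X \<Rightarrow> hd ys / 2 | Y \<Rightarrow> (hd ys + 1) / 2))"
    have "y # ys \<in> descent_lists (l # v)" "code (y # ys) = w'"
      using w' ys h
      by (cases s; cases l; force simp: y_def Cons_descent_lists hd_code field_simps split: if_splits)+
    then show "w' \<in> code ` descent_lists (l # v)" by blast
  qed
qed

lemma finite_marks: "finite (marks v)"
proof (induction v)
  case (Cons l v)
  have "marks (l # v) \<subseteq> (\<lambda>(s, w). s # w) ` ({AtZero, AtOne, Tied, Free} \<times> marks v)"
  proof
    fix w' assume "w' \<in> marks (l # v)"
    then obtain s w where "w' = s # w" "w \<in> marks v" by auto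
    then show "w' \<in> (\<lambda>(s, w). s # w) ` ({AtZero, AtOne, Tied, Free} \<times> marks v)"
      by (cases s) auto
  qed
  then show ?case using Cons by (meson finite.emptyI finite_SigmaI finite_imageI finite_insert finite_subset)
qed auto

section \<open>A linear recursion for the f-polynomial\<close>

definition dim_poly :: "mark list set \<Rightarrow> nat poly" where
  "dim_poly A = (\<Sum>w\<in>A. monom 1 (count_list w Free))"

lemma coeff_dim_poly:
  assumes "finite A" shows "coeff (dim_poly A) i = card {w \<in> A. count_list w Free = i}"
proof -
  have "coeff (dim_poly A) i = (\<Sum>w\<in>A. if count_list w Free = i then 1 else 0)"
    by (auto simp: dim_poly_def coeff_sum intro: sum.cong)
  also have "\<dots> = card {w \<in> A. count_list w Free = i}"
    using assms by (simp flip: sum.inter_filter)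
  finally show ?thesis .
qed

text \<open>
  The polynomials below count the words of \<^const>\<open>marks\<close>, with the exponent recording the number of \<open>Free\<close>
  marks. Summing over the possible first marks gives the recursion in the word.
\<close>

definition starting :: "letter list \<Rightarrow> mark \<Rightarrow> nat poly" where
  "starting v s = dim_poly {w \<in> marks v. hd w = s}"

lemma UNIV_mark: "UNIV = {AtZero, AtOne, Tied, Free}"
  using mark.exhaust by auto

lemma dim_poly_by_hd:
  "dim_poly {w \<in> marks v. P (hd w)} = (\<Sum>r | P r. starting v r)"
proof -
  have fin: "finite {r. P r}" by (rule finite_subset[OF subset_UNIV]) (simp add: UNIV_mark)
  have "(\<Sum>r | P r. starting v r) =
        (\<Sum>r | P r. \<Sum>w | w \<in> {w \<in> marks v. P (hd w)} \<and> hd w = r. monom 1 (count_list w Free))"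
    unfolding starting_def dim_poly_def by (intro sum.cong) auto
  also have "\<dots> = dim_poly {w \<in> marks v. P (hd w)}"
    unfolding dim_poly_def by (intro sum.group) (auto simp: fin finite_marks)
  finally show ?thesis by simp
qed

lemma dim_poly_Cons:
  "dim_poly ((#) s ` A) = (if s = Free then pCons 0 (dim_poly A) else dim_poly A)"
proof -
  have "dim_poly ((#) s ` A) = (\<Sum>w\<in>A. monom 1 (count_list (s # w) Free))"
    by (simp add: dim_poly_def sum.reindex)
  moreover have "pCons 0 (dim_poly A) = (\<Sum>w\<in>A. pCons 0 (monom 1 (count_list w Free)))"
    unfolding dim_poly_def
    by (rule poly_eqI) (simp add: coeff_sum coeff_pCons split: nat.split)
  ultimately show ?thesis by (simp add: monom_Suc dim_poly_def)
qed

lemma starting_Cons: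
  "starting (l # v) s = (if s = Free then pCons 0 (\<Sum>r | may_precede l s r. starting v r)
     else (\<Sum>r | may_precede l s r. starting v r))"
proof -
  have "{w \<in> marks (l # v). hd w = s} = (#) s ` {w \<in> marks v. may_precede l s (hd w)}"
    by auto
  then show ?thesis
    by (simp add: starting_def[of "l # v"] dim_poly_Cons dim_poly_by_hd del: marks.simps)
qed

text \<open>
  The faces on which the first coordinate is not constantly 1, those on which it is not constantly 0, and
  all nonempty faces. In terms of these three sums the recursion becomes simple.
\<close>

definition low :: "letter list \<Rightarrow> nat poly" where
  "low v = dim_poly {w \<in> marks v. hd w \<noteq> AtOne}"

definition high :: "letter list \<Rightarrow> nat poly" where
  "high v = dim_poly {w \<in> marks v. hd w \<noteq> AtZero}"

definition face_poly :: "letter list \<Rightarrow> nat poly" where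
  "face_poly v = dim_poly (marks v)"

lemma low_eq: "low v = starting v AtZero + starting v Tied + starting v Free"
proof -
  have "{r. r \<noteq> AtOne} = {AtZero, Tied, Free}" using mark.exhaust by auto
  then show ?thesis unfolding low_def dim_poly_by_hd[where P = "\<lambda>s. s \<noteq> AtOne"] by (simp add: add.assoc)
qed

lemma high_eq: "high v = starting v AtOne + starting v Tied + starting v Free"
proof -
  have "{r. r \<noteq> AtZero} = {AtOne, Tied, Free}" using mark.exhaust by auto
  then show ?thesis unfolding high_def dim_poly_by_hd[where P = "\<lambda>s. s \<noteq> AtZero"] by (simp add: add.assoc)
qed

lemma face_poly_eq: "face_poly v = starting v AtZero + starting v AtOne + starting v Tied + starting v Free"
  using dim_poly_by_hd[of v "\<lambda>_. True"] by (simp add: face_poly_def UNIV_mark add.assoc)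

lemma precede_sets:
  "{r. may_precede X AtZero r} = {AtZero, AtOne, Tied, Free}" "{r. may_precede X AtOne r} = {AtOne}"
  "{r. may_precede X Free r} = {AtOne, Tied, Free}" "{r. may_precede l Tied r} = {Tied, Free}"
  "{r. may_precede Y AtOne r} = {AtZero, AtOne, Tied, Free}" "{r. may_precede Y AtZero r} = {AtZero}"
  "{r. may_precede Y Free r} = {AtZero, Tied, Free}"
  using mark.exhaust by auto

text \<open>
  A new coordinate below the old first one is either constantly 0, or it
  copies the old first coordinate (factor 1), or it is a free coordinate of its own (factor \<open>t\<close>); the
  last two possibilities give new faces exactly if the old first coordinate is not constantly 0. This
  explains the formula for \<^const>\<open>face_poly\<close>, and the others are obtained in the same way.
\<close>

lemma transfer_X:
  "high (X # v) = [:1, 1:] * high v"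
  "low (X # v) = low v + [:1, 1:] * high v"
  "face_poly (X # v) = face_poly v + [:1, 1:] * high v"
  by (simp_all add: low_eq high_eq face_poly_eq starting_Cons precede_sets ac_simps flip: One_nat_def)

lemma transfer_Y:
  "low (Y # v) = [:1, 1:] * low v"
  "high (Y # v) = high v + [:1, 1:] * low v"
  "face_poly (Y # v) = face_poly v + [:1, 1:] * low v"
  by (simp_all add: low_eq high_eq face_poly_eq starting_Cons precede_sets ac_simps flip: One_nat_def)

lemma low_high_Nil: "low [] = [:1, 1:]" "high [] = [:1, 1:]"
proof -
  have "{w \<in> marks []. hd w \<noteq> AtOne} = {[AtZero], [Free]}" "{w \<in> marks []. hd w \<noteq> AtZero} = {[AtOne], [Free]}"
    by auto
  then show "low [] = [:1, 1:]" "high [] = [:1, 1:]"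
    by (simp_all add: low_def high_def dim_poly_def monom_Suc monom_0 del: marks.simps)
qed

section \<open>Comparison with alternating words\<close>

text \<open>
  The next letter contributes \<open>1 + t\<close> times \<^const>\<open>low\<close> or \<^const>\<open>high\<close>. The larger of the two is
  the one used by a letter different from the first letter of the word; for the empty word they agree. Naming the two by size
  instead of by letter makes the recursion the same for both alternating words.
\<close>

definition big :: "letter list \<Rightarrow> nat poly" where
  "big v = (if v \<noteq> [] \<and> hd v = Y then high v else low v)"

definition small :: "letter list \<Rightarrow> nat poly" where
  "small v = (if v \<noteq> [] \<and> hd v = Y then low v else high v)"

lemma turn:
  assumes "v = [] \<or> hd v \<noteq> l"
  shows "big (l # v) = small v + [:1, 1:] * big v"
    and "small (l # v) = [:1, 1:] * big v"
    and "face_poly (l # v) = face_poly v + [:1, 1:] * big v"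
  using assms
  by (cases l; cases "v = []"; cases "hd v";
      force simp: big_def small_def transfer_X transfer_Y low_high_Nil)+

lemma stay:
  assumes "v \<noteq> []" "hd v = l"
  shows "big (l # v) = big v + [:1, 1:] * small v"
    and "small (l # v) = [:1, 1:] * small v"
    and "face_poly (l # v) = face_poly v + [:1, 1:] * small v"
  using assms by (cases l; force simp: big_def small_def transfer_X transfer_Y)+

lemma coeff_one_plus_t:
  "coeff ([:1, 1:] * p) i = coeff p i + (if i = 0 then 0 else coeff p (i - 1))" for p :: "nat poly"
  by (cases i) auto

lemma small_le_big: "coeff (small v) i \<le> coeff (big v) i"
proof (induction v arbitrary: i)
  case Nil
  then show ?case by (simp add: big_def small_def low_high_Nil)
next
  case (Cons l v)
  then show ?case
    by (cases "v = [] \<or> hd v \<noteq> l") (auto simp: turn stay simp del: mult_pCons_left)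
qed

lemma small_pos: "i \<le> Suc (length v) \<Longrightarrow> 0 < coeff (small v) i"
proof (induction v arbitrary: i)
  case Nil
  then show ?case by (cases i) (simp_all add: small_def low_high_Nil)
next
  case (Cons l v)
  have "0 < coeff (small v) i \<or> (i \<noteq> 0 \<and> 0 < coeff (small v) (i - 1))"
    using Cons by (cases "i \<le> Suc (length v)") auto
  then have "0 < coeff ([:1, 1:] * small v) i"
    unfolding coeff_one_plus_t by auto
  moreover have "coeff ([:1, 1:] * small v) i \<le> coeff ([:1, 1:] * big v) i"
    unfolding coeff_one_plus_t by (simp add: add_mono small_le_big)
  ultimately show ?case
    using turn(2)[of v l] stay(2)[of v l] by (cases "v = [] \<or> hd v \<noteq> l") auto
qed

lemma small_less_big:
  assumes "v \<noteq> []" "i \<le> length v"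
  shows "coeff (small v) i < coeff (big v) i"
proof -
  obtain l v' where v: "v = l # v'" using assms by (cases v) auto
  have "0 < coeff (small v') i" "0 < coeff (big v') i"
    using small_pos[of i v'] small_le_big[of v' i] assms v by auto
  then show ?thesis unfolding v
    by (cases "v' = [] \<or> hd v' \<noteq> l") (auto simp: turn stay simp del: mult_pCons_left)
qed

lemma distinct_adj_Cons_iff: "distinct_adj (l # v) \<longleftrightarrow> (v = [] \<or> hd v \<noteq> l) \<and> distinct_adj v"
  by (cases v) auto

text \<open>
  The step for a different letter is monotone in \<^const>\<open>small\<close>, \<^const>\<open>big\<close> and \<^const>\<open>face_poly\<close>, and it
  dominates the step for a repeated letter: with \<open>q = 1 + t\<close>, the two values of \<^const>\<open>big\<close> differ by
  \<open>(small + q big) - (big + q small) = t (big - small)\<close>, and those of \<^const>\<open>small\<close> and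
  \<^const>\<open>face_poly\<close> differ by \<open>q (big - small)\<close>. All these differences have nonnegative coefficients.
\<close>

lemma alternating_dominates:
  assumes "length v = length u" "alternating u"
  shows "coeff (small v) i \<le> coeff (small u) i \<and> coeff (big v) i \<le> coeff (big u) i \<and>
    coeff (face_poly v) i \<le> coeff (face_poly u) i"
  using assms
proof (induction v u arbitrary: i rule: list_induct2)
  case Nil
  then show ?case by simp
next
  case (Cons l v k u)
  have u: "u = [] \<or> hd u \<noteq> k" "alternating u" using Cons.prems by (auto simp: distinct_adj_Cons_iff)
  note IH = Cons.IH[OF u(2)]
  show ?case
  proof (cases "v = [] \<or> hd v \<noteq> l")
    case True
    show ?thesis
      unfolding turn[OF True] turn[OF u(1)] coeff_add coeff_one_plus_t
      using IH[of i] IH[of "i - 1"] by auto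
  next
    case False
    then have s: "v \<noteq> []" "hd v = l" by auto
    show ?thesis
      unfolding stay[OF s] turn[OF u(1)] coeff_add coeff_one_plus_t
      using IH[of i] IH[of "i - 1"] small_le_big[of v i] small_le_big[of v "i - 1"] by auto
  qed
qed

text \<open>
  When a letter is first repeated, \<open>big - small\<close> has positive coefficients up to the
  length of the word read so far (\<open>small_less_big\<close>), so the gap \<open>q (big - small)\<close> of the face counts is
  strict in all required degrees. Each further letter requires one more degree; its coefficient gets a
  strict gap from the term \<open>t big\<close>, which is why the strict inequality for the coefficient
  of \<^const>\<open>big\<close> in degree \<open>length v\<close> is carried along.
\<close>

lemma alternating_strictly_dominates:
  assumes "length v = length u" "alternating u" "\<not> alternating v"
  shows "coeff (big v) (length v) < coeff (big u) (length v) \<and>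
    (\<forall>i\<le>length v. coeff (face_poly v) i < coeff (face_poly u) i)"
  using assms
proof (induction v u rule: list_induct2)
  case Nil
  then show ?case by simp
next
  case (Cons l v k u)
  have u: "u = [] \<or> hd u \<noteq> k" "alternating u" using Cons.prems by (auto simp: distinct_adj_Cons_iff)
  note D = alternating_dominates[OF Cons.hyps u(2)]
  show ?case
  proof (cases "alternating v")
    case True
    then have s: "v \<noteq> []" "hd v = l" using Cons.prems by (auto simp: distinct_adj_Cons_iff)
    have B: "coeff (small v) i < coeff (big u) i" if "i \<le> length v" for i
      using small_less_big[OF s(1) that] D[of i] by linarith
    have "coeff ([:1, 1:] * small v) i < coeff ([:1, 1:] * big u) i" if "i \<le> Suc (length v)" for i
    proof (cases "i \<le> length v")
      case True
      then show ?thesis unfolding coeff_one_plus_t using B[of i] B[of "i - 1"]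
        by (cases i) (auto intro: add_strict_mono)
    next
      case False
      then have "i = Suc (length v)" using that by simp
      then show ?thesis unfolding coeff_one_plus_t using B[of "length v"]
         D[of "Suc (length v)"] small_le_big[of v "Suc (length v)"] by simp
    qed
    then have T: "\<forall>i\<le>length (l # v). coeff (face_poly (l # v)) i < coeff (face_poly (k # u)) i"
      unfolding stay[OF s] turn[OF u(1)] coeff_add using D by (simp add: add_le_less_mono)
    \<comment> \<open>Before the first repetition both words are alternating, so the counts agree.\<close>
    have "small v = small u" "big v = big u"
      using alternating_dominates[OF Cons.hyps u(2)] alternating_dominates[OF Cons.hyps[symmetric] True]
      by (simp_all add: poly_eq_iff antisym)
    then show ?thesis
      using T B[of "length v"] unfolding stay[OF s] turn[OF u(1)] coeff_add coeff_one_plus_t by simp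
  next
    case False
    note IH = Cons.IH[OF u(2) False]
    let ?m = "length v"
    have "coeff (big (l # v)) (Suc ?m) < coeff (big (k # u)) (Suc ?m) \<and>
      coeff (face_poly (l # v)) i < coeff (face_poly (k # u)) i" if "i \<le> Suc ?m" for i
    proof (cases "v = [] \<or> hd v \<noteq> l")
      case t: True
      show ?thesis
        using D[of "Suc ?m"] D[of i] D[of "i - 1"] IH that
        unfolding turn[OF t] turn[OF u(1)] coeff_add coeff_one_plus_t
        by (cases "i = Suc ?m") (auto simp: add_less_le_mono add_le_less_mono add_le_mono)
    next
      case t: False
      then have s: "v \<noteq> []" "hd v = l" by auto
      show ?thesis
        using D[of "Suc ?m"] D[of i] D[of "i - 1"] IH that
          small_le_big[of v i] small_le_big[of v "i - 1"] small_le_big[of v "?m"]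
          small_le_big[of v "Suc ?m"]
        unfolding stay[OF s] turn[OF u(1)] coeff_add coeff_one_plus_t
        by (cases "i = Suc ?m") (fastforce dest: spec[of _ i])+
    qed
    from this[of 0] this show ?thesis by auto
  qed
qed

section \<open>The f-vector of a descent polytope\<close>

definition path_coords :: "(nat \<Rightarrow> 'n::finite) \<Rightarrow> nat \<Rightarrow> real ^ 'n \<Rightarrow> real list" where
  "path_coords e n x = map (\<lambda>i. x $ e (Suc i)) [0..<n]"

definition halfspaces :: "(nat \<Rightarrow> 'n::finite) \<Rightarrow> letter list \<Rightarrow> ((real ^ 'n) \<times> real) set" where
  "halfspaces e v = (\<Union>j. {(- axis j 1, 0), (axis j 1, 1)}) \<union>
     (\<lambda>i. (case v ! i of X \<Rightarrow> axis (e (Suc i)) 1 - axis (e (Suc (Suc i))) 1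
                       | Y \<Rightarrow> axis (e (Suc (Suc i))) 1 - axis (e (Suc i)) 1, 0)) ` {..<length v}"

lemma finite_halfspaces: "finite (halfspaces e v)"
  by (auto simp: halfspaces_def)

lemma cut_out_halfspaces: "cut_out (halfspaces e v) = DP e v"
proof -
  have "x \<in> cut_out (halfspaces e v) \<longleftrightarrow> x \<in> DP e v" for x
    by (simp add: cut_out_def halfspaces_def DP_def ball_Un inner_axis' inner_diff_left
          Ball_def[of "{..<length v}"] split: letter.splits)
  then show ?thesis by blast
qed

lemma tight_halfspaces_subset:
  "tight (halfspaces e v) x \<subseteq> tight (halfspaces e v) y \<longleftrightarrow>
     (\<forall>j. (x $ j = 0 \<longrightarrow> y $ j = 0) \<and> (x $ j = 1 \<longrightarrow> y $ j = 1)) \<and>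
     (\<forall>i<length v. x $ e (Suc i) = x $ e (Suc (Suc i)) \<longrightarrow> y $ e (Suc i) = y $ e (Suc (Suc i)))"
proof -
  let ?h = "\<lambda>i. case v ! i of X \<Rightarrow> axis (e (Suc i)) (1::real) - axis (e (Suc (Suc i))) 1
                       | Y \<Rightarrow> axis (e (Suc (Suc i))) 1 - axis (e (Suc i)) 1"
  have h: "?h i \<bullet> w = 0 \<longleftrightarrow> w $ e (Suc i) = w $ e (Suc (Suc i))" for i w
    by (auto simp: inner_axis' inner_diff_left split: letter.split)
  have "tight (halfspaces e v) x \<subseteq> tight (halfspaces e v) y \<longleftrightarrow>
     (\<forall>(a, b)\<in>halfspaces e v. a \<bullet> x = b \<longrightarrow> a \<bullet> y = b)"
    by (auto simp: tight_def)
  also have "\<dots> \<longleftrightarrow>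
     (\<forall>j. (x $ j = 0 \<longrightarrow> y $ j = 0) \<and> (x $ j = 1 \<longrightarrow> y $ j = 1)) \<and>
     (\<forall>i<length v. ?h i \<bullet> x = 0 \<longrightarrow> ?h i \<bullet> y = 0)"
    by (auto simp: halfspaces_def ball_Un inner_axis')
  finally show ?thesis unfolding h .
qed

lemma card_image_cong:
  assumes "\<And>x y. x \<in> A \<Longrightarrow> y \<in> A \<Longrightarrow> f x = f y \<longleftrightarrow> g x = g y"
  shows "card (f ` A) = card (g ` A)"
proof (rule bij_betw_same_card)
  show "bij_betw (\<lambda>u. g (inv_into A f u)) (f ` A) (g ` A)"
  proof (rule bij_betw_imageI)
    show "inj_on (\<lambda>u. g (inv_into A f u)) (f ` A)"
    proof (rule inj_onI)
      fix p q assume *: "p \<in> f ` A" "q \<in> f ` A" "g (inv_into A f p) = g (inv_into A f q)"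
      then have "f (inv_into A f p) = f (inv_into A f q)"
        using assms inv_into_into[of _ f A] by blast
      then show "p = q" using *(1,2) by (simp add: f_inv_into_f)
    qed
    have "g (inv_into A f (f x)) = g x" if "x \<in> A" for x
      using assms[of "inv_into A f (f x)" x] that by (simp add: f_inv_into_f inv_into_into)
    then show "(\<lambda>u. g (inv_into A f u)) ` f ` A = g ` A"
      by (auto simp: image_image)
  qed
qed

locale coordinate_path =
  fixes e :: "nat \<Rightarrow> 'n::finite" and v :: "letter list"
  assumes bij: "bij_betw e {1..Suc (length v)} UNIV"
begin

abbreviation "n \<equiv> Suc (length v)"
abbreviation "coords \<equiv> path_coords e n"
abbreviation "H \<equiv> halfspaces e v"

lemma bij_Suc: "bij_betw (\<lambda>i. e (Suc i)) {..<n} UNIV"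
proof -
  have "bij_betw Suc {..<n} {1..n}"
    by (metis atLeast0LessThan bij_betw_Suc image_Suc_atLeastLessThan One_nat_def
        atLeastLessThanSuc_atLeastAtMost)
  from bij_betw_trans[OF this bij] show ?thesis by (simp add: o_def)
qed

lemma all_coordinates: "(\<forall>j. P j) \<longleftrightarrow> (\<forall>i<n. P (e (Suc i)))"
  using bij_betw_imp_surj_on[OF bij_Suc] by (metis UNIV_I imageE lessThan_iff)

lemma coords_nth [simp]: "i < n \<Longrightarrow> coords x ! i = x $ e (Suc i)"
  by (simp add: path_coords_def del: upt_Suc)

lemma length_coords [simp]: "length (coords x) = n"
  by (simp add: path_coords_def)

lemma coords_in_descent_lists: "coords x \<in> descent_lists v \<longleftrightarrow> x \<in> DP e v"
  unfolding descent_lists_def DP_def all_set_conv_all_nth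
  by (auto simp: all_coordinates[where P = "\<lambda>j. 0 \<le> x $ j \<and> x $ j \<le> 1"] split: letter.splits)

lemma coords_image: "coords ` DP e v = descent_lists v"
proof
  show "descent_lists v \<subseteq> coords ` DP e v"
  proof
    fix ys assume ys: "ys \<in> descent_lists v"
    define x :: "real ^ 'n" where "x = (\<chi> j. ys ! inv_into {..<n} (\<lambda>i. e (Suc i)) j)"
    have "coords x = ys"
    proof (rule nth_equalityI)
      show "length (coords x) = length ys" using ys by (simp add: descent_lists_def)
      show "coords x ! i = ys ! i" if "i < length (coords x)" for i
        using that bij_betw_inv_into_left[OF bij_Suc, of i] by (simp add: x_def)
    qed
    then show "ys \<in> coords ` DP e v" using ys coords_in_descent_lists by (metis image_eqI)
  qed
qed (use coords_in_descent_lists in blast)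

lemma nth_code_coords:
  "i < n \<Longrightarrow> code (coords x) ! i = (if x $ e (Suc i) = 0 then AtZero else if x $ e (Suc i) = 1 then AtOne
     else if i < length v \<and> x $ e (Suc (Suc i)) = x $ e (Suc i) then Tied else Free)"
  by (auto simp: nth_code)

lemma tight_eq_iff_code_eq: "tight H x = tight H y \<longleftrightarrow> code (coords x) = code (coords y)"
proof
  assume "tight H x = tight H y"
  then have "(x $ j = 0 \<longleftrightarrow> y $ j = 0) \<and> (x $ j = 1 \<longleftrightarrow> y $ j = 1)"
     "i < length v \<Longrightarrow> x $ e (Suc (Suc i)) = x $ e (Suc i) \<longleftrightarrow> y $ e (Suc (Suc i)) = y $ e (Suc i)" for i j
    using tight_halfspaces_subset[of e v x y] tight_halfspaces_subset[of e v y x] by (metis order_refl)+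
  then show "code (coords x) = code (coords y)"
    by (intro nth_equalityI) (auto simp: nth_code_coords)
next
  have "tight H x \<subseteq> tight H y" if *: "code (coords x) = code (coords y)" for x y
    unfolding tight_halfspaces_subset all_coordinates
  proof (intro conjI allI impI)
    have c: "code (coords x) ! i = code (coords y) ! i" for i using * by simp
    show "y $ e (Suc i) = 0" if "i < n" "x $ e (Suc i) = 0" for i
      using c[of i] that by (simp add: nth_code_coords split: if_splits)
    show "y $ e (Suc i) = 1" if "i < n" "x $ e (Suc i) = 1" for i
      using c[of i] that by (simp add: nth_code_coords split: if_splits)
    show "y $ e (Suc i) = y $ e (Suc (Suc i))" if "i < length v" "x $ e (Suc i) = x $ e (Suc (Suc i))" for i
      using c[of i] c[of "Suc i"] that by (auto simp: nth_code_coords split: if_splits)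
  qed
  then show "tight H x = tight H y" if "code (coords x) = code (coords y)" using that by (metis subset_antisym)
qed

text \<open>
  Replacing each \<open>Tied\<close> coordinate by its difference with the next one is a unitriangular change of
  coordinates. It turns the direction space of the face into the space spanned by the
  coordinates marked \<open>Free\<close>.
\<close>

lemma aff_dim_face_through_eq_count:
  assumes "x \<in> DP e v"
  shows "aff_dim (face_through H x) = int (count_list (code (coords x)) Free)"
proof -
  \<comment> \<open>The direction space of the face.\<close>
  define V :: "(real ^ 'n) set" where "V = {d. (\<forall>i<n. x $ e (Suc i) = 0 \<or> x $ e (Suc i) = 1 \<longrightarrow> d $ e (Suc i) = 0) \<and>
    (\<forall>i<length v. x $ e (Suc i) = x $ e (Suc (Suc i)) \<longrightarrow> d $ e (Suc i) = d $ e (Suc (Suc i)))}"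
  define c where "c i = code (coords x) ! i" for i
  define pos where "pos = inv_into {..<n} (\<lambda>i. e (Suc i))"
  have pos [simp]: "pos (e (Suc i)) = i" if "i < n" for i
    unfolding pos_def using that bij_betw_inv_into_left[OF bij_Suc] by simp
  define T :: "real ^ 'n \<Rightarrow> real ^ 'n" where
    "T d = (\<chi> j. if c (pos j) = Tied then d $ j - d $ e (Suc (Suc (pos j))) else d $ j)" for d
  have T_nth: "T d $ e (Suc i) = (if c i = Tied then d $ e (Suc i) - d $ e (Suc (Suc i)) else d $ e (Suc i))"
    if "i < n" for d i using that by (simp add: T_def)
  have Tied_imp: "i < length v \<and> x $ e (Suc i) = x $ e (Suc (Suc i)) \<and> x $ e (Suc i) \<noteq> 0 \<and> x $ e (Suc i) \<noteq> 1"
    if "c i = Tied" "i < n" for i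
    using that by (auto simp: c_def nth_code_coords split: if_splits)
  have "linear T" by (rule linearI) (auto simp: T_def vec_eq_iff algebra_simps)
  moreover have "inj T"
  proof (subst linear_injective_0[OF \<open>linear T\<close>], intro allI impI)
    fix d assume Td: "T d = 0"
    \<comment> \<open>Downwards from the last coordinate, which is never \<open>Tied\<close>.\<close>
    have "d $ e (Suc i) = 0" if "i \<le> length v" for i
      using that
    proof (induction rule: inc_induct)
      case base
      then show ?case using T_nth[of "length v" d] Td Tied_imp[of "length v"] by (auto split: if_splits)
    next
      case (step i)
      then show ?case using T_nth[of i d] Td by (auto split: if_splits)
    qed
    then show "d = 0" by (auto simp: vec_eq_iff all_coordinates less_Suc_eq_le simp del: less_Suc_eq)
  qed
  ultimately have "surj T" by (rule linear_injective_imp_surjective[OF _ _ refl])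
  define D where "D = (\<lambda>i. e (Suc i)) ` {i. i < n \<and> c i = Free}"
  have D_iff: "e (Suc i) \<in> D \<longleftrightarrow> c i = Free" if "i < n" for i
    using that bij_betw_imp_inj_on[OF bij_Suc] by (auto simp: D_def inj_on_def)
  have "d \<in> V \<longleftrightarrow> T d \<in> {w. \<forall>j. j \<notin> D \<longrightarrow> w $ j = 0}" for d
  proof -
    have "T d \<in> {w. \<forall>j. j \<notin> D \<longrightarrow> w $ j = 0} \<longleftrightarrow>
      (\<forall>i<n. c i \<noteq> Free \<longrightarrow> T d $ e (Suc i) = 0)"
      unfolding mem_Collect_eq all_coordinates using D_iff by auto
    also have "\<dots> \<longleftrightarrow> d \<in> V"
    proof
      assume R: "\<forall>i<n. c i \<noteq> Free \<longrightarrow> T d $ e (Suc i) = 0"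
      have fixed: "d $ e (Suc i) = 0" if "i < n" "x $ e (Suc i) = 0 \<or> x $ e (Suc i) = 1" for i
        using that R[rule_format, of i] T_nth[of i d] nth_code_coords[of i x]
        by (auto simp: c_def split: if_splits)
      moreover have "d $ e (Suc i) = d $ e (Suc (Suc i))"
        if i: "i < length v" "x $ e (Suc i) = x $ e (Suc (Suc i))" for i
      proof (cases "x $ e (Suc i) = 0 \<or> x $ e (Suc i) = 1")
        case True
        then show ?thesis using fixed[of i] fixed[of "Suc i"] i by auto
      next
        case False
        then have "c i = Tied" using i by (simp add: c_def nth_code_coords)
        then show ?thesis using R i T_nth[of i d] by auto
      qed
      ultimately show "d \<in> V" by (auto simp: V_def)
    next
      assume d: "d \<in> V"
      show "\<forall>i<n. c i \<noteq> Free \<longrightarrow> T d $ e (Suc i) = 0"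
      proof (intro allI impI)
        fix i assume i: "i < n" "c i \<noteq> Free"
        show "T d $ e (Suc i) = 0"
        proof (cases "c i = Tied")
          case True
          then show ?thesis using Tied_imp[OF True i(1)] d T_nth[OF i(1)] by (auto simp: V_def)
        next
          case False
          then have "x $ e (Suc i) = 0 \<or> x $ e (Suc i) = 1"
            using i by (auto simp: c_def nth_code_coords split: if_splits)
          then show ?thesis using False i(1) d T_nth[OF i(1)] by (auto simp: V_def)
        qed
      qed
    qed
    finally show ?thesis by blast
  qed
  then have TV: "T ` V = {w. \<forall>j. j \<notin> D \<longrightarrow> w $ j = 0}"
    using \<open>surj T\<close> by (auto simp: image_iff) (metis surjD)
  have "subspace V" by (auto simp: V_def subspace_def)
  have "dim V = dim (T ` V)"
    using \<open>linear T\<close> \<open>inj T\<close> by (metis dim_image_eq inj_on_subset top_greatest)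
  also have "\<dots> = card D" unfolding TV using dim_substandard_cart[of D, where 'a = real] by (simp add: dim_vec_eq)
  also have "card D = card {i. i < n \<and> c i = Free}"
    unfolding D_def using bij_betw_imp_inj_on[OF bij_Suc] by (intro card_image) (auto simp: inj_on_def)
  also have "\<dots> = count_list (code (coords x)) Free"
    by (simp add: count_list_eq_length_filter length_filter_conv_card c_def eq_commute[of Free])
  finally have dimV: "dim V = count_list (code (coords x)) Free" .
  have "{y. tight H x \<subseteq> tight H y} = (+) x ` V"
  proof -
    have "y \<in> {y. tight H x \<subseteq> tight H y} \<longleftrightarrow> y - x \<in> V" for y
      unfolding mem_Collect_eq tight_halfspaces_subset all_coordinates V_def by auto
    then show ?thesis by (auto simp: image_iff) (metis add_diff_cancel_left' diff_add_cancel add.commute)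
  qed
  then show ?thesis
    using aff_dim_face_through[OF finite_halfspaces[of e v], of x] assms aff_dim_subspace[OF \<open>subspace V\<close>] dimV
    by (simp add: cut_out_halfspaces aff_dim_translation_eq)
qed

text \<open>
  Faces correspond to tight sets, and tight sets to words; the dimension of a face is the number of
  \<open>Free\<close> marks in its word.
\<close>

lemma f_vector_DP: "f_vector (DP e v) d = coeff (face_poly v) d"
proof -
  let ?A = "{x \<in> DP e v. count_list (code (coords x)) Free = d}"
  have "{F. F face_of DP e v \<and> aff_dim F = int d} = face_through H ` ?A"
  proof (intro equalityI subsetI)
    fix F assume F: "F \<in> {F. F face_of DP e v \<and> aff_dim F = int d}"
    then have "F \<noteq> {}" by auto
    with F obtain x where "x \<in> DP e v" "F = face_through H x"
      using face_eq_face_through[OF finite_halfspaces[of e v], of F] by (auto simp: cut_out_halfspaces)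
    then show "F \<in> face_through H ` ?A" using F aff_dim_face_through_eq_count by auto
  qed (use face_through_face_of[of H] aff_dim_face_through_eq_count in \<open>auto simp: cut_out_halfspaces\<close>)
  then have "f_vector (DP e v) d = card (face_through H ` ?A)" by (simp add: f_vector_def)
  also have "\<dots> = card ((\<lambda>x. code (coords x)) ` ?A)"
    by (rule card_image_cong) (simp add: face_through_eq_iff cut_out_halfspaces tight_eq_iff_code_eq)
  also have "(\<lambda>x. code (coords x)) ` ?A = {w \<in> code ` coords ` DP e v. count_list w Free = d}" by auto
  also have "\<dots> = {w \<in> marks v. count_list w Free = d}" by (simp only: coords_image code_descent_lists)
  finally show ?thesis by (simp add: face_poly_def coeff_dim_poly finite_marks)
qed

end

lemma alternating_z: "alternating (z m)" "alternating (z_bar m)"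
  by (auto simp: z_def z_bar_def distinct_adj_conv_nth)

theorem corollary2p5:
  fixes n :: nat and e :: "nat \<Rightarrow> 'n::finite"
  assumes "n \<ge> 1" and "bij_betw e {1..n} (UNIV :: 'n set)"
  shows "(\<forall>v. length v = n - 1 \<longrightarrow>
            f_vector (DP e v) \<le> f_vector (DP e (z (n - 1))) \<and>
            f_vector (DP e v) \<le> f_vector (DP e (z_bar (n - 1)))) \<and>
         (\<forall>i v. i \<le> n - 1 \<and> length v = n - 1 \<and> \<not> alternating v \<longrightarrow>
            f_vector (DP e v) i < f_vector (DP e (z (n - 1))) i)"
proof -
  have f: "f_vector (DP e v) i = coeff (face_poly v) i" if "length v = n - 1" for v :: "letter list" and i
  proof -
    interpret coordinate_path e v using assms that by unfold_locales simp
    show ?thesis by (rule f_vector_DP)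
  qed
  have len: "length (z (n - 1)) = n - 1" "length (z_bar (n - 1)) = n - 1"
    by (simp_all add: z_def z_bar_def)
  show ?thesis
  proof (intro conjI allI impI le_funI)
    fix v :: "letter list" and i assume "length v = n - 1"
    then show "f_vector (DP e v) i \<le> f_vector (DP e (z (n - 1))) i"
      and "f_vector (DP e v) i \<le> f_vector (DP e (z_bar (n - 1))) i"
      using alternating_dominates[of v "z (n - 1)" i] alternating_dominates[of v "z_bar (n - 1)" i]
        alternating_z[of "n - 1"] f[of v i] f[OF len(1), of i] f[OF len(2), of i] len by simp_all
  next
    fix i v assume "i \<le> n - 1 \<and> length v = n - 1 \<and> \<not> alternating v"
    then show "f_vector (DP e v) i < f_vector (DP e (z (n - 1))) i"
      using alternating_strictly_dominates[of v "z (n - 1)"] alternating_z[of "n - 1"]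
        f[of v i] f[OF len(1), of i] len by simp
  qed
qed

end
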